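(* Let $f_0\in\mathcal{Y}_2(B_1^m,\mathbb{Q})$ be strictly defined with $\mathrm{Dir}(f_0;B_1^m)<\infty$ and $\|\xi\circ f_0\|_{\mathcal{L}^2}<\infty$. For $h>0$ let $F_h:[0,\infty)\times B_1^m\to\mathbb{Q}$ be the function obtained by interpolating the step minimizing sequence $(f_h^k)_{k\ge0}$ starting at $f_0$ (defined in the context), write $F_k$ for $F_h$ with $h=1/2^k$, and let $F:[0,\infty)\times B_1^m\to\mathbb{Q}$ be a weak limit in $\mathcal{Y}_2$ (on $[0,T]\times B_1^m$ for every $T>0$) of a subsequence of $(F_k)$. Put $F_t(x)=F(t,x)$. Then the flow is Hölder continuous with respect to the $\mathcal{L}^2$ norm, i.e. $$\|\xi\circ F_t-\xi\circ F_s\|_{\mathcal{L}^2}\le\sqrt{s-t}\,\sqrt{\mathrm{Dir}(f_0;B_1^m)}$$ for $\mathcal{L}^1$-almost every $t,s$ with $0\le t<s$.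
   Context: $\mathbb{Q}=\mathbb{Q}_Q(\mathbb{R}^n)$ is the set of unordered $Q$-tuples $\sum_{i=1}^Q[[p_i]]$ of points $p_i\in\mathbb{R}^n$ (repetitions allowed), with metric $\mathcal{G}(\sum_i[[p_i]],\sum_i[[q_i]])=\min_\sigma(\sum_i|p_i-q_{\sigma(i)}|^2)^{1/2}$ over permutations $\sigma$; $|\sum_i[[p_i]]|^2=\sum_i|p_i|^2$. $B_1^m=\{x\in\mathbb{R}^m:|x|\le1\}$. Embedding: for an orthogonal projection $\pi:\mathbb{R}^n\to\mathbb{R}$ let $\zeta(\pi,\sum_i[[p_i]])\in\mathbb{R}^Q$ be the nondecreasing rearrangement of $\pi(p_1),\dots,\pi(p_Q)$. Throughout, $\xi:\mathbb{Q}\to\mathbb{R}^{PQ}$ is a fixed map (White's modification of Almgren's embedding): a suitable positive multiple of the concatenation of $\zeta(\Pi_1,\cdot),\dots,\zeta(\Pi_P,\cdot)$, where $\Pi_1,\dots,\Pi_P$ are the complete sets of coordinate projections of finitely many orthonormal coordinate systems of $\mathbb{R}^n$, chosen so that $\xi$ is bi-Lipschitz onto its closed image $\mathbb{Q}^*=\xi(\mathbb{Q})$; moreover $|\xi(p)|=|p|$, and $|\xi(p)-\xi(q)|=\mathcal{G}(p,q)$ for $q$ sufficiently near $p$. Also fixed is a Lipschitz map $\rho:\mathbb{R}^{PQ}\to\mathbb{R}^{PQ}$ with $\rho(\mathbb{R}^{PQ})\subset\mathbb{Q}^*$ and $\rho(x)=x$ for $x\in\mathbb{Q}^*$ (such a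 map exists by Almgren). $\mathcal{Y}_2(A,V)$ ($V$ a Euclidean space) is the space of square summable functions $A\to V$ with square summable distributional first derivatives, and $\mathcal{Y}_2(A,\mathbb{Q})$ is the set of $f:A\to\mathbb{Q}$ with $\xi\circ f\in\mathcal{Y}_2(A,\mathbb{R}^{PQ})$. Weak convergence $u_k\rightharpoonup u$ in $\mathcal{Y}_2$ means $\xi\circ u_k\rightharpoonup\xi\circ u$ weakly in $W^{1,2}$. $\mathrm{Dir}(f;A)=\int_A|D(\xi_0\circ f)|^2=\int_A|D(\xi\circ f)|^2$, where $\xi_0$ is the concatenation of the maps $\zeta(x_i,\cdot)$ for the standard coordinate projections. A locally summable $V$-valued $f$ is strictly defined if $f(x)=y$ whenever the averages of $|f-y|$ over $B^m(x,r)$ tend to $0$ as $r\downarrow0$; a $\mathbb{Q}$-valued $f$ is strictly defined if $\xi\circ f$ is. Boundary values: $f\in\mathcal{Y}_2(B_1^m,V)$ has boundary values $g:\partial B_1^m\to V$ iff there is a strictly defined $w\in\mathcal{Y}_2(\mathbb{R}^m,V)$ with $w=f$ a.e. on $B_1^m$ and $w=g$ $\mathcal{H}^{m-1}$-a.e. on $\partial B_1^m$; for $\mathbb{Q}$-valued functions apply this to $\xi\circ f$, $\xi\circ g$. Step minimizing sequence: let $\mathcal{M}$ be the set of strictly defined $u\in\mathcal{Y}_2(B_1^m,\mathbb{Q})$ with $u=f_0$ on $\partial B_1^m$ (same boundary values). Given $h>0$, set $f_h^0=f_0$ and for $k\ge1$ let $f_h^k\in\mathcal{M}$ minimize over $g\in\mathcal{M}$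 the functional $G(f_h^{k-1},g,h)=\mathrm{Dir}(g;B_1^m)+\frac{1}{h/2^k}\|\xi\circ f_h^{k-1}-\xi\circ g\|_{\mathcal{L}^2}^2$ (minimizers exist). Interpolation: for $i=1,2,3,\dots$, $F_h(t,x)=f_h^{i-1}(x)$ if $t\in[(i-1)h,\,ih-\frac{h}{2^i}]$, and $F_h(t,x)=\xi^{-1}\circ\rho\Big(\frac{ih-t}{h/2^i}\,\xi(f_h^{i-1}(x))+\frac{t-(ih-h/2^i)}{h/2^i}\,\xi(f_h^i(x))\Big)$ if $t\in[ih-\frac{h}{2^i},\,ih]$. *)

theory Defs
  imports "HOL-Analysis.Analysis"
begin

section \<open>Unordered tuples\<close>

text \<open>An unordered \<open>Q\<close>-tuple of points is a multiset of size \<open>Q\<close>.\<close>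

definition qtuples :: "nat \<Rightarrow> 'a multiset set"
  where "qtuples Q = {p. size p = Q}"

definition qdist :: "'a::real_normed_vector multiset \<Rightarrow> 'a multiset \<Rightarrow> real"
  where "qdist p q =
    Min {sqrt (\<Sum>i<size p. (norm (xs ! i - ys ! \<sigma> i))\<^sup>2) | xs ys \<sigma>.
      mset xs = p \<and> mset ys = q \<and> \<sigma> permutes {..<size p}}"

definition qnorm :: "'a::real_normed_vector multiset \<Rightarrow> real"
  where "qnorm p = sqrt (\<Sum>v\<in>#p. (norm v)\<^sup>2)"

text \<open>The index type \<open>'q\<close> plays the role of \<open>{1..Q}\<close>, so that \<open>Q = CARD('q)\<close>;
  the position of \<open>j\<close> in its linear order is the number of its predecessors.\<close>

definition zeta :: "('a \<Rightarrow> real) \<Rightarrow> 'a multiset \<Rightarrow> real ^ 'q::{finite,linorder}"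
  where "zeta \<pi> p = (\<chi> j. sorted_list_of_multiset (image_mset \<pi> p) ! card {k. k < j})"

definition xi0 :: "(real ^ 'n) multiset \<Rightarrow> real ^ 'q::{finite,linorder} ^ 'n"
  where "xi0 p = (\<chi> i. zeta (\<lambda>v. v $ i) p)"

text \<open>\<open>e c\<close> is the \<open>c\<close>-th orthonormal coordinate system; the \<open>P\<close> projections are indexed by
  \<open>'c \<times> 'n\<close>, and \<open>real ^ 'q ^ ('c \<times> 'n)\<close> with its Euclidean norm is the target space of
  dimension \<open>P * Q\<close>.\<close>

definition white_embedding ::
    "((real ^ 'n) multiset \<Rightarrow> real ^ 'q::{finite,linorder} ^ ('c::finite \<times> 'n)) \<Rightarrow> bool"
  where "white_embedding \<xi> \<longleftrightarrow>
    (\<exists>(e :: 'c \<Rightarrow> 'n \<Rightarrow> real ^ 'n) (\<kappa>::real).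
      (\<forall>c i j. e c i \<bullet> e c j = (if i = j then 1 else 0)) \<and> \<kappa> > 0 \<and>
      (\<forall>p\<in>qtuples CARD('q). \<xi> p = \<kappa> *\<^sub>R (\<chi> k. zeta (\<lambda>v. v \<bullet> e (fst k) (snd k)) p))) \<and>
    (\<exists>a b. a > 0 \<and> (\<forall>p\<in>qtuples CARD('q). \<forall>q\<in>qtuples CARD('q).
      a * qdist p q \<le> norm (\<xi> p - \<xi> q) \<and> norm (\<xi> p - \<xi> q) \<le> b * qdist p q)) \<and>
    closed (\<xi> ` qtuples CARD('q)) \<and>
    (\<forall>p\<in>qtuples CARD('q). norm (\<xi> p) = qnorm p) \<and>
    (\<forall>p\<in>qtuples CARD('q). \<exists>\<epsilon>>0. \<forall>q\<in>qtuples CARD('q).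
      qdist p q < \<epsilon> \<longrightarrow> norm (\<xi> p - \<xi> q) = qdist p q)"

definition lipschitz_retraction_onto :: "'v::real_normed_vector set \<Rightarrow> ('v \<Rightarrow> 'v) \<Rightarrow> bool"
  where "lipschitz_retraction_onto S \<rho> \<longleftrightarrow>
    (\<exists>L. L-lipschitz_on UNIV \<rho>) \<and> range \<rho> \<subseteq> S \<and> (\<forall>x\<in>S. \<rho> x = x)"


section \<open>Sobolev functions\<close>

definition square_integrable ::
    "'a::euclidean_space set \<Rightarrow> ('a \<Rightarrow> 'v::euclidean_space) \<Rightarrow> bool"
  where "square_integrable A f \<longleftrightarrow>
    f \<in> borel_measurable (lebesgue_on A) \<and> integrable (lebesgue_on A) (\<lambda>x. (norm (f x))\<^sup>2)"

definition l2norm :: "'a::euclidean_space set \<Rightarrow> ('a \<Rightarrow> 'v::euclidean_space) \<Rightarrow> real"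
  where "l2norm A f = sqrt (\<integral>x. (norm (f x))\<^sup>2 \<partial>lebesgue_on A)"

definition locally_summable ::
    "'a::euclidean_space set \<Rightarrow> ('a \<Rightarrow> 'v::euclidean_space) \<Rightarrow> bool"
  where "locally_summable A f \<longleftrightarrow>
    (\<forall>x\<in>A. \<exists>r>0. integrable (lebesgue_on (A \<inter> cball x r)) f)"

primrec Ck :: "nat \<Rightarrow> ('a::euclidean_space \<Rightarrow> real) \<Rightarrow> bool"
  where
    "Ck 0 = (\<lambda>\<phi>. continuous_on UNIV \<phi>)"
  | "Ck (Suc k) = (\<lambda>\<phi>. (\<forall>x. \<phi> differentiable (at x)) \<and>
      (\<forall>i\<in>Basis. Ck k (\<lambda>x. frechet_derivative \<phi> (at x) i)))"

definition test_function :: "'a::euclidean_space set \<Rightarrow> ('a \<Rightarrow> real) \<Rightarrow> bool"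
  where "test_function U \<phi> \<longleftrightarrow>
    (\<forall>k. Ck k \<phi>) \<and> compact (closure {x. \<phi> x \<noteq> 0}) \<and> closure {x. \<phi> x \<noteq> 0} \<subseteq> U"

text \<open>Distributional derivatives on \<open>A\<close> are those on the interior of \<open>A\<close>; below, \<open>A\<close> always
  has a negligible boundary.\<close>

definition has_weak_partial :: "'a::euclidean_space set \<Rightarrow> 'a \<Rightarrow>
    ('a \<Rightarrow> 'v::euclidean_space) \<Rightarrow> ('a \<Rightarrow> 'v) \<Rightarrow> bool"
  where "has_weak_partial A i f g \<longleftrightarrow>
    locally_summable (interior A) f \<and> locally_summable (interior A) g \<and>
    (\<forall>\<phi>. test_function (interior A) \<phi> \<longrightarrow>
      (\<integral>x. frechet_derivative \<phi> (at x) i *\<^sub>R f x \<partial>lebesgue_on (interior A)) =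
      - (\<integral>x. \<phi> x *\<^sub>R g x \<partial>lebesgue_on (interior A)))"

definition weak_partial :: "'a::euclidean_space set \<Rightarrow> 'a \<Rightarrow>
    ('a \<Rightarrow> 'v::euclidean_space) \<Rightarrow> 'a \<Rightarrow> 'v"
  where "weak_partial A i f = (SOME g. has_weak_partial A i f g)"

definition Y2 :: "'a::euclidean_space set \<Rightarrow> ('a \<Rightarrow> 'v::euclidean_space) set"
  where "Y2 A = {f. square_integrable A f \<and>
    (\<forall>i\<in>Basis. \<exists>g. has_weak_partial A i f g \<and> square_integrable (interior A) g)}"

definition Y2_norm :: "'a::euclidean_space set \<Rightarrow> ('a \<Rightarrow> 'v::euclidean_space) \<Rightarrow> real"
  where "Y2_norm A f =
    sqrt ((l2norm A f)\<^sup>2 + (\<Sum>i\<in>Basis. (l2norm (interior A) (weak_partial A i f))\<^sup>2))"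

definition Y2_functional ::
    "'a::euclidean_space set \<Rightarrow> (('a \<Rightarrow> 'v::euclidean_space) \<Rightarrow> real) \<Rightarrow> bool"
  where "Y2_functional A \<Lambda> \<longleftrightarrow>
    (\<forall>u\<in>Y2 A. \<forall>v\<in>Y2 A. \<Lambda> (\<lambda>x. u x + v x) = \<Lambda> u + \<Lambda> v) \<and>
    (\<forall>u\<in>Y2 A. \<forall>c. \<Lambda> (\<lambda>x. c *\<^sub>R u x) = c * \<Lambda> u) \<and>
    (\<exists>C. \<forall>u\<in>Y2 A. \<bar>\<Lambda> u\<bar> \<le> C * Y2_norm A u)"

definition Y2_weakly_converges :: "'a::euclidean_space set \<Rightarrow>
    (nat \<Rightarrow> 'a \<Rightarrow> 'v::euclidean_space) \<Rightarrow> ('a \<Rightarrow> 'v) \<Rightarrow> bool"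
  where "Y2_weakly_converges A u v \<longleftrightarrow>
    (\<forall>k. u k \<in> Y2 A) \<and> v \<in> Y2 A \<and>
    (\<forall>\<Lambda>. Y2_functional A \<Lambda> \<longrightarrow> (\<lambda>k. \<Lambda> (u k)) \<longlonglongrightarrow> \<Lambda> v)"

text \<open>At boundary points of \<open>A\<close> the averages are taken over the part of the ball inside \<open>A\<close>.\<close>

definition strictly_defined ::
    "'a::euclidean_space set \<Rightarrow> ('a \<Rightarrow> 'v::euclidean_space) \<Rightarrow> bool"
  where "strictly_defined A f \<longleftrightarrow> locally_summable A f \<and>
    (\<forall>x\<in>A. \<forall>y.
      ((\<lambda>r. (\<integral>z. norm (f z - y) \<partial>lebesgue_on (A \<inter> cball x r)) /
        measure lebesgue (A \<inter> cball x r)) \<longlongrightarrow> 0) (at_right 0) \<longrightarrow> f x = y)"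

text \<open>The case distinction makes the empty set contribute \<open>0\<close> also for \<open>k = 0\<close>,
  while a singleton then contributes \<open>1\<close>.\<close>

definition hausdorff_measure :: "nat \<Rightarrow> 'a::euclidean_space set \<Rightarrow> ennreal"
  where "hausdorff_measure k A =
    (SUP \<delta>\<in>{0<..}. INF C\<in>{C :: nat \<Rightarrow> 'a set.
        A \<subseteq> (\<Union>i. C i) \<and> (\<forall>i. bounded (C i) \<and> diameter (C i) \<le> \<delta>)}.
      (\<Sum>i. if C i = {} then 0
        else ennreal (unit_ball_vol (real k) * (diameter (C i) / 2) ^ k)))"

abbreviation unit_cball :: "'a::euclidean_space set"
  where "unit_cball \<equiv> cball 0 1"

definition has_boundary_values ::
    "('a::euclidean_space \<Rightarrow> 'v::euclidean_space) \<Rightarrow> ('a \<Rightarrow> 'v) \<Rightarrow> bool"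
  where "has_boundary_values f g \<longleftrightarrow> f \<in> Y2 unit_cball \<and>
    (\<exists>w\<in>Y2 UNIV. strictly_defined UNIV w \<and>
      (AE x in lebesgue_on unit_cball. w x = f x) \<and>
      hausdorff_measure (DIM('a) - 1) {x \<in> sphere 0 1. w x \<noteq> g x} = 0)"


section \<open>Functions with values in unordered tuples\<close>

definition Y2_Q :: "((real ^ 'n) multiset \<Rightarrow> real ^ 'q::{finite,linorder} ^ 'p::finite) \<Rightarrow>
    'a::euclidean_space set \<Rightarrow> ('a \<Rightarrow> (real ^ 'n) multiset) set"
  where "Y2_Q \<xi> A = {f. (\<forall>x\<in>A. f x \<in> qtuples CARD('q)) \<and> \<xi> \<circ> f \<in> Y2 A}"

text \<open>The first argument only fixes \<open>Q = CARD('q)\<close>.\<close>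

definition Dir :: "'q::{finite,linorder} itself \<Rightarrow> ('a::euclidean_space \<Rightarrow> (real ^ 'n) multiset) \<Rightarrow>
    'a set \<Rightarrow> ennreal"
  where "Dir _ f A = (\<integral>\<^sup>+x. ennreal (\<Sum>i\<in>Basis.
      (norm (weak_partial A i ((xi0 :: _ \<Rightarrow> real ^ 'q::{finite,linorder} ^ 'n) \<circ> f) x))\<^sup>2) \<partial>lebesgue_on (interior A))"

text \<open>``The same boundary values'' as \<open>f0\<close>: there are boundary values common to both functions
  (they are unique up to null sets on the sphere).\<close>

definition competitors ::
    "((real ^ 'n) multiset \<Rightarrow> real ^ 'q::{finite,linorder} ^ 'p::finite) \<Rightarrow>
      ('a::euclidean_space \<Rightarrow> (real ^ 'n) multiset) \<Rightarrow> ('a \<Rightarrow> (real ^ 'n) multiset) set"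
  where "competitors \<xi> f0 = {u \<in> Y2_Q \<xi> unit_cball.
    strictly_defined unit_cball (\<xi> \<circ> u) \<and>
    (\<exists>g. (\<forall>x\<in>sphere 0 1. g x \<in> qtuples CARD('q)) \<and>
      has_boundary_values (\<xi> \<circ> f0) (\<xi> \<circ> g) \<and> has_boundary_values (\<xi> \<circ> u) (\<xi> \<circ> g))}"

definition step_functional ::
    "((real ^ 'n) multiset \<Rightarrow> real ^ 'q::{finite,linorder} ^ 'p::finite) \<Rightarrow> nat \<Rightarrow>
      ('a::euclidean_space \<Rightarrow> (real ^ 'n) multiset) \<Rightarrow> ('a \<Rightarrow> (real ^ 'n) multiset) \<Rightarrow>
      real \<Rightarrow> ennreal"
  where "step_functional \<xi> k u g h = Dir TYPE('q) g unit_cball +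
    ennreal (1 / (h / 2 ^ k) * (l2norm unit_cball (\<lambda>x. \<xi> (u x) - \<xi> (g x)))\<^sup>2)"

definition step_minimizing ::
    "((real ^ 'n) multiset \<Rightarrow> real ^ 'q::{finite,linorder} ^ 'p::finite) \<Rightarrow>
      ('a::euclidean_space \<Rightarrow> (real ^ 'n) multiset) \<Rightarrow> real \<Rightarrow>
      (nat \<Rightarrow> 'a \<Rightarrow> (real ^ 'n) multiset) \<Rightarrow> bool"
  where "step_minimizing \<xi> f0 h f \<longleftrightarrow> f 0 = f0 \<and>
    (\<forall>k\<ge>1. f k \<in> competitors \<xi> f0 \<and>
      (\<forall>g\<in>competitors \<xi> f0.
        step_functional \<xi> k (f (k - 1)) (f k) h \<le> step_functional \<xi> k (f (k - 1)) g h))"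

text \<open>Here \<open>i\<close> is the index with \<open>(i - 1) * h \<le> t < i * h\<close>. At the common endpoints of the time
  intervals the different clauses agree; see the two lemmas below.\<close>

definition interpolation ::
    "((real ^ 'n) multiset \<Rightarrow> real ^ 'q::{finite,linorder} ^ 'p::finite) \<Rightarrow>
      (real ^ 'q::{finite,linorder} ^ 'p::finite \<Rightarrow> real ^ 'q::{finite,linorder} ^ 'p::finite) \<Rightarrow> real \<Rightarrow>
      (nat \<Rightarrow> 'a \<Rightarrow> (real ^ 'n) multiset) \<Rightarrow> real \<times> 'a \<Rightarrow> (real ^ 'n) multiset"
  where "interpolation \<xi> \<rho> h f = (\<lambda>(t, x).
    let i = nat \<lfloor>t / h\<rfloor> + 1 in
    if t \<le> real i * h - h / 2 ^ i then f (i - 1) x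
    else inv_into (qtuples CARD('q)) \<xi> (\<rho>
      (((real i * h - t) / (h / 2 ^ i)) *\<^sub>R \<xi> (f (i - 1) x) +
       ((t - (real i * h - h / 2 ^ i)) / (h / 2 ^ i)) *\<^sub>R \<xi> (f i x))))"

lemma interpolation_index:
  assumes "h > 0" "i \<ge> 1" "(real i - 1) * h \<le> t" "t < real i * h"
  shows "nat \<lfloor>t / h\<rfloor> + 1 = i"
proof -
  have "real_of_int (int i - 1) \<le> t / h" "t / h < real_of_int (int i - 1) + 1"
    using assms by (auto simp: field_simps)
  then have "\<lfloor>t / h\<rfloor> = int i - 1" by (rule floor_unique)
  with assms(2) show ?thesis by simp
qed

lemma interpolation_constant:
  assumes "h > 0" "i \<ge> 1" "t \<in> {(real i - 1) * h..real i * h - h / 2 ^ i}"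
  shows "interpolation \<xi> \<rho> h f (t, x) = f (i - 1) x"
proof -
  have "h / 2 ^ i > 0" using assms(1) by simp
  moreover have "t \<le> real i * h - h / 2 ^ i" using assms(3) by simp
  ultimately have "t < real i * h" by linarith
  then have "nat \<lfloor>t / h\<rfloor> + 1 = i" using assms by (intro interpolation_index) auto
  with assms(3) show ?thesis by (simp only: interpolation_def prod.case Let_def) simp
qed

lemma interpolation_transition:
  fixes \<xi> :: "(real ^ 'n) multiset \<Rightarrow> real ^ 'q::{finite,linorder} ^ 'p::finite"
  assumes "h > 0" "i \<ge> 1" "t \<in> {real i * h - h / 2 ^ i..real i * h}"
    and inj: "inj_on \<xi> (qtuples CARD('q))"
    and \<rho>: "lipschitz_retraction_onto (\<xi> ` qtuples CARD('q)) \<rho>"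
    and f: "\<And>k. f k x \<in> qtuples CARD('q)"
  shows "interpolation \<xi> \<rho> h f (t, x) = inv_into (qtuples CARD('q)) \<xi> (\<rho>
      (((real i * h - t) / (h / 2 ^ i)) *\<^sub>R \<xi> (f (i - 1) x) +
       ((t - (real i * h - h / 2 ^ i)) / (h / 2 ^ i)) *\<^sub>R \<xi> (f i x)))"
proof -
  have pos: "h / 2 ^ i > 0" using assms(1) by simp
  have le: "h / 2 ^ k \<le> h" for k :: nat
    using assms(1) mult_left_mono[of 1 "2 ^ k" h] by (simp add: divide_le_eq)
  have inv: "inv_into (qtuples CARD('q)) \<xi> (\<rho> (\<xi> (f k x))) = f k x" for k
    using \<rho> f inj by (simp add: lipschitz_retraction_onto_def)
  consider "t = real i * h - h / 2 ^ i" | "t = real i * h"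
    | "real i * h - h / 2 ^ i < t" "t < real i * h"
    using assms(3) by fastforce
  then show ?thesis
  proof cases
    case 1
    have "interpolation \<xi> \<rho> h f (t, x) = f (i - 1) x"
      using 1 le[of i] assms(1,2) by (intro interpolation_constant) (auto simp: algebra_simps)
    moreover have "(real i * h - t) / (h / 2 ^ i) = 1" "t - (real i * h - h / 2 ^ i) = 0"
      using 1 pos by auto
    ultimately show ?thesis by (simp add: inv[simplified])
  next
    case 2
    have "interpolation \<xi> \<rho> h f (t, x) = f (i + 1 - 1) x"
      using 2 le[of "i + 1"] assms(1) by (intro interpolation_constant) (auto simp: algebra_simps)
    moreover have "(t - (real i * h - h / 2 ^ i)) / (h / 2 ^ i) = 1" "real i * h - t = 0"
      using 2 pos by auto
    ultimately show ?thesis by (simp add: inv[simplified])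
  next
    case 3
    then have "nat \<lfloor>t / h\<rfloor> + 1 = i"
      using assms(1,2) le[of i] by (intro interpolation_index) (auto simp: algebra_simps)
    with 3 show ?thesis by (simp only: interpolation_def prod.case Let_def) simp
  qed
qed

end

theory Submission
  imports Defs
begin

text \<open>
  Write \<open>D = Dir f\<^sub>0\<close>. Comparing \<open>f\<^sub>h\<^sup>k\<close> with the competitor \<open>f\<^sub>h\<^bsup>k-1\<^esup>\<close> and telescoping gives
  \<open>\<Sum>k. 2\<^sup>k / h * \<parallel>\<xi> \<circ> f\<^sub>h\<^bsup>k-1\<^esup> - \<xi> \<circ> f\<^sub>h\<^sup>k\<parallel>\<^sup>2 \<le> D\<close>. As the weights \<open>1 / 2\<^sup>k\<close> are summable, the
  Cauchy-Schwarz inequality bounds the total displacement: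
  \<open>\<parallel>\<xi> \<circ> f\<^sub>h\<^sup>k - \<xi> \<circ> f\<^sub>0\<parallel>\<^sup>2 \<le> h * D\<close> for every \<open>k\<close>. Since \<open>\<rho>\<close> is Lipschitz and fixes the values of
  \<open>\<xi>\<close>, the interpolations converge to \<open>\<xi> \<circ> f\<^sub>0\<close> in \<open>L\<^sup>2\<close>, uniformly in time, as \<open>h\<close> tends to \<open>0\<close>.
  Pairing with an \<open>L\<^sup>2\<close> function is a bounded functional on \<open>Y2\<close>, so the weak limit is the same
  function: the flow is stationary, so the left-hand side of the estimate is \<open>0\<close> for almost every \<open>t\<close> and \<open>s\<close>.
\<close>

lemma measurable_fst_lebesgue:
  "fst \<in> (lebesgue :: ('a::euclidean_space \<times> 'b::euclidean_space) measure) \<rightarrow>\<^sub>M lebesgue"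
proof (rule completion.measurable_completion2)
  show m: "fst \<in> (lebesgue :: ('a \<times> 'b) measure) \<rightarrow>\<^sub>M lborel"
    by (intro measurable_completion) (simp add: borel_prod[symmetric])
  show "null_sets lborel \<subseteq> null_sets (distr (lebesgue :: ('a \<times> 'b) measure) lborel fst)"
  proof
    fix N :: "'a set" assume N: "N \<in> null_sets lborel"
    have "(N \<times> UNIV :: ('a \<times> 'b) set) \<in> null_sets (lborel \<Otimes>\<^sub>M lborel)"
      using N by (intro lborel.times_in_null_sets1) auto
    then have "(N \<times> UNIV :: ('a \<times> 'b) set) \<in> null_sets lebesgue"
      by (simp add: lborel_prod null_sets_completionI)
    moreover have "fst -` N = (N \<times> UNIV :: ('a \<times> 'b) set)" by auto
    ultimately show "N \<in> null_sets (distr (lebesgue :: ('a \<times> 'b) measure) lborel fst)"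
      using N m by (auto simp: null_sets_distr_iff)
  qed
qed

lemma measurable_snd_lebesgue:
  "snd \<in> (lebesgue :: ('a::euclidean_space \<times> 'b::euclidean_space) measure) \<rightarrow>\<^sub>M lebesgue"
proof (rule completion.measurable_completion2)
  show m: "snd \<in> (lebesgue :: ('a \<times> 'b) measure) \<rightarrow>\<^sub>M lborel"
    by (intro measurable_completion) (simp add: borel_prod[symmetric])
  show "null_sets lborel \<subseteq> null_sets (distr (lebesgue :: ('a \<times> 'b) measure) lborel snd)"
  proof
    fix N :: "'b set" assume N: "N \<in> null_sets lborel"
    have "(UNIV \<times> N :: ('a \<times> 'b) set) \<in> null_sets (lborel \<Otimes>\<^sub>M lborel)"
      using N by (intro lborel.times_in_null_sets2) auto
    then have "(UNIV \<times> N :: ('a \<times> 'b) set) \<in> null_sets lebesgue"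
      by (simp add: lborel_prod null_sets_completionI)
    moreover have "snd -` N = (UNIV \<times> N :: ('a \<times> 'b) set)" by auto
    ultimately show "N \<in> null_sets (distr (lebesgue :: ('a \<times> 'b) measure) lborel snd)"
      using N m by (auto simp: null_sets_distr_iff)
  qed
qed

lemma lebesgue_Times:
  fixes A :: "'a::euclidean_space set" and B :: "'b::euclidean_space set"
  assumes "A \<in> sets lebesgue" "B \<in> sets lebesgue"
  shows "A \<times> B \<in> sets lebesgue"
proof -
  have "A \<times> B = (fst -` A \<inter> space lebesgue) \<inter> (snd -` B \<inter> space lebesgue)" by auto
  also have "\<dots> \<in> sets lebesgue"
    using assms by (intro sets.Int measurable_sets[OF measurable_fst_lebesgue]
        measurable_sets[OF measurable_snd_lebesgue])
  finally show ?thesis .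
qed

lemma AE_lebesgue_pair:
  fixes P :: "'a::euclidean_space \<times> 'b::euclidean_space \<Rightarrow> bool"
  assumes "AE z in lebesgue. P z"
  shows "AE t in lebesgue. AE x in lebesgue. P (t, x)"
proof -
  have "AE z in lborel \<Otimes>\<^sub>M lborel. P z"
    using assms unfolding AE_completion_iff lborel_prod .
  then show ?thesis unfolding AE_completion_iff by (rule lborel_pair.AE_pair)
qed

lemma nn_integral_lebesgue_pair:
  fixes u :: "'a::euclidean_space \<times> 'b::euclidean_space \<Rightarrow> ennreal"
  assumes "u \<in> borel_measurable lebesgue"
  shows "(\<integral>\<^sup>+z. u z \<partial>lebesgue) = (\<integral>\<^sup>+t. (\<integral>\<^sup>+x. u (t, x) \<partial>lebesgue) \<partial>lebesgue)"
proof -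
  obtain v where v: "v \<in> borel_measurable lborel" and uv: "AE z in lborel. u z = v z"
    using completion_ex_borel_measurable[OF assms] by blast
  have v': "v \<in> borel_measurable (lborel \<Otimes>\<^sub>M lborel)"
    using v by (simp add: lborel_prod)
  have "AE z in lebesgue. u z = v z" using uv by (simp add: AE_completion_iff)
  then have ae: "AE t in lebesgue. AE x in lebesgue. u (t, x) = v (t, x)"
    by (rule AE_lebesgue_pair)
  have "(\<integral>\<^sup>+z. u z \<partial>lebesgue) = (\<integral>\<^sup>+z. v z \<partial>lborel \<Otimes>\<^sub>M lborel)"
    unfolding nn_integral_completion lborel_prod using uv by (rule nn_integral_cong_AE)
  also have "\<dots> = (\<integral>\<^sup>+t. (\<integral>\<^sup>+x. v (t, x) \<partial>lebesgue) \<partial>lebesgue)"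
    using v' by (simp add: nn_integral_completion lborel.nn_integral_fst)
  also have "\<dots> = (\<integral>\<^sup>+t. (\<integral>\<^sup>+x. u (t, x) \<partial>lebesgue) \<partial>lebesgue)"
    using ae by (intro nn_integral_cong_AE) (auto elim!: eventually_mono intro!: nn_integral_cong_AE)
  finally show ?thesis .
qed

lemma nn_integral_lebesgue_on_Times:
  fixes u :: "'a::euclidean_space \<times> 'b::euclidean_space \<Rightarrow> ennreal"
  assumes A: "A \<in> sets lebesgue" and B: "B \<in> sets lebesgue"
    and u: "u \<in> borel_measurable (lebesgue_on (A \<times> B))"
  shows "(\<integral>\<^sup>+z. u z \<partial>lebesgue_on (A \<times> B)) =
    (\<integral>\<^sup>+t. (\<integral>\<^sup>+x. u (t, x) \<partial>lebesgue_on B) \<partial>lebesgue_on A)"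
proof -
  have AB: "A \<times> B \<in> sets lebesgue" using A B by (rule lebesgue_Times)
  have "(\<lambda>z. u z * indicator (A \<times> B) z) \<in> borel_measurable lebesgue"
    using u AB by (simp add: borel_measurable_restrict_space_iff_ennreal)
  from nn_integral_lebesgue_pair[OF this] have
    "(\<integral>\<^sup>+z. u z \<partial>lebesgue_on (A \<times> B)) =
      (\<integral>\<^sup>+t. (\<integral>\<^sup>+x. u (t, x) * indicator (A \<times> B) (t, x) \<partial>lebesgue) \<partial>lebesgue)"
    using AB by (simp add: nn_integral_restrict_space)
  also have "\<dots> = (\<integral>\<^sup>+t. (\<integral>\<^sup>+x. u (t, x) * indicator B x \<partial>lebesgue) * indicator A t \<partial>lebesgue)"
    by (intro nn_integral_cong) (auto simp: indicator_def)
  also have "\<dots> = (\<integral>\<^sup>+t. (\<integral>\<^sup>+x. u (t, x) \<partial>lebesgue_on B) \<partial>lebesgue_on A)"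
    using A B by (simp add: nn_integral_restrict_space)
  finally show ?thesis .
qed

lemma square_integrable_snd:
  fixes g :: "'b::euclidean_space \<Rightarrow> 'v::euclidean_space" and A :: "'a::euclidean_space set"
  assumes A: "A \<in> lmeasurable" and B: "B \<in> sets lebesgue" and g: "square_integrable B g"
  shows "square_integrable (A \<times> B) (\<lambda>z. g (snd z))"
proof -
  have AB: "A \<times> B \<in> sets lebesgue" using A B by (intro lebesgue_Times) auto
  have m: "(\<lambda>z. g (snd z)) \<in> borel_measurable (lebesgue_on (A \<times> B))"
  proof (rule measurable_compose[where g = g])
    show "snd \<in> lebesgue_on (A \<times> B) \<rightarrow>\<^sub>M lebesgue_on B"
      by (intro measurable_restrict_space3 measurable_snd_lebesgue) auto
    show "g \<in> borel_measurable (lebesgue_on B)" using g by (simp add: square_integrable_def)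
  qed
  have fin: "(\<integral>\<^sup>+x. ennreal ((norm (g x))\<^sup>2) \<partial>lebesgue_on B) < \<infinity>"
    using g by (simp add: square_integrable_def integrable_iff_bounded)
  have "(\<integral>\<^sup>+z. ennreal ((norm (g (snd z)))\<^sup>2) \<partial>lebesgue_on (A \<times> B)) =
    (\<integral>\<^sup>+t. (\<integral>\<^sup>+x. ennreal ((norm (g x))\<^sup>2) \<partial>lebesgue_on B) \<partial>lebesgue_on A)"
    using A B m by (subst nn_integral_lebesgue_on_Times) auto
  also have "\<dots> < \<infinity>"
    using fin A by (auto simp: emeasure_restrict_space space_restrict_space ennreal_mult_less_top
        fmeasurable_def)
  finally show ?thesis
    using m by (simp add: square_integrable_def integrable_iff_bounded)
qed

lemma square_integrable_nn_integral:
  assumes "square_integrable A f"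
  shows "(\<integral>\<^sup>+x. ennreal ((norm (f x))\<^sup>2) \<partial>lebesgue_on A) = ennreal ((l2norm A f)\<^sup>2)"
  using assms by (simp add: square_integrable_def l2norm_def nn_integral_eq_integral)

lemma square_integrable_diff:
  assumes "square_integrable A f" "square_integrable A g"
  shows "square_integrable A (\<lambda>x. f x - g x)"
proof -
  have [measurable]: "f \<in> borel_measurable (lebesgue_on A)" "g \<in> borel_measurable (lebesgue_on A)"
    and int: "integrable (lebesgue_on A) (\<lambda>x. 2 * (norm (f x))\<^sup>2 + 2 * (norm (g x))\<^sup>2)"
    using assms by (auto simp: square_integrable_def)
  have "(norm (f x - g x))\<^sup>2 \<le> 2 * (norm (f x))\<^sup>2 + 2 * (norm (g x))\<^sup>2" for x
  proof -
    have "(norm (f x - g x))\<^sup>2 \<le> (norm (f x) + norm (g x))\<^sup>2"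
      by (intro power_mono norm_triangle_ineq4) auto
    also have "\<dots> \<le> 2 * (norm (f x))\<^sup>2 + 2 * (norm (g x))\<^sup>2"
      using zero_le_power2[of "norm (f x) - norm (g x)"]
      by (simp add: power2_eq_square algebra_simps)
    finally show ?thesis .
  qed
  then have "integrable (lebesgue_on A) (\<lambda>x. (norm (f x - g x))\<^sup>2)"
    by (intro Bochner_Integration.integrable_bound[OF int]) auto
  then show ?thesis by (simp add: square_integrable_def)
qed

lemma
  assumes u: "square_integrable A u" and w: "square_integrable A w"
  shows integrable_inner_square_integrable: "integrable (lebesgue_on A) (\<lambda>x. u x \<bullet> w x)"
    and integral_inner_le_l2norm:
      "\<bar>\<integral>x. u x \<bullet> w x \<partial>lebesgue_on A\<bar> \<le> l2norm A u * l2norm A w"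
proof -
  have [measurable]: "u \<in> borel_measurable (lebesgue_on A)" "w \<in> borel_measurable (lebesgue_on A)"
    using u w by (auto simp: square_integrable_def)
  let ?I = "\<integral>\<^sup>+x. ennreal (norm (u x \<bullet> w x)) \<partial>lebesgue_on A"
  have "?I \<le> (\<integral>\<^sup>+x. ennreal (norm (u x)) * ennreal (norm (w x)) \<partial>lebesgue_on A)"
    by (intro nn_integral_mono)
      (simp add: Cauchy_Schwarz_ineq2 flip: ennreal_mult)
  then have "?I\<^sup>2 \<le> (\<integral>\<^sup>+x. ennreal (norm (u x)) * ennreal (norm (w x)) \<partial>lebesgue_on A)\<^sup>2"
    by (rule power_mono) simp
  also have "\<dots> \<le> ennreal ((l2norm A u)\<^sup>2) * ennreal ((l2norm A w)\<^sup>2)"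
    using Cauchy_Schwarz_nn_integral[of "\<lambda>x. ennreal (norm (u x))" "lebesgue_on A"
        "\<lambda>x. ennreal (norm (w x))"] square_integrable_nn_integral[OF u]
      square_integrable_nn_integral[OF w] by (simp add: ennreal_power)
  also have "\<dots> = (ennreal (l2norm A u * l2norm A w))\<^sup>2"
    by (simp add: ennreal_power l2norm_def power_mult_distrib flip: ennreal_mult)
  finally have sq: "?I\<^sup>2 \<le> (ennreal (l2norm A u * l2norm A w))\<^sup>2" .
  also have "\<dots> < \<infinity>" by (simp add: power_less_top_ennreal)
  finally have fin: "?I < \<infinity>" by (simp add: power_less_top_ennreal)
  then obtain i where i: "0 \<le> i" "?I = ennreal i" by (cases ?I) auto
  have pos: "0 \<le> l2norm A u * l2norm A w" by (simp add: l2norm_def)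
  have "i \<le> l2norm A u * l2norm A w"
  proof (rule power2_le_imp_le[OF _ pos])
    have "ennreal (i\<^sup>2) \<le> ennreal ((l2norm A u * l2norm A w)\<^sup>2)"
      using sq unfolding i(2) ennreal_power[OF i(1)] ennreal_power[OF pos] .
    then show "i\<^sup>2 \<le> (l2norm A u * l2norm A w)\<^sup>2" by simp
  qed
  with i have le: "?I \<le> ennreal (l2norm A u * l2norm A w)" by (simp add: ennreal_leI)
  from fin show int: "integrable (lebesgue_on A) (\<lambda>x. u x \<bullet> w x)"
    by (simp add: integrable_iff_bounded)
  have "ennreal \<bar>\<integral>x. u x \<bullet> w x \<partial>lebesgue_on A\<bar> \<le> ?I"
    using integral_norm_bound_ennreal[OF int] by simp
  also note le
  finally show "\<bar>\<integral>x. u x \<bullet> w x \<partial>lebesgue_on A\<bar> \<le> l2norm A u * l2norm A w"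
    by (simp add: l2norm_def)
qed

lemma Y2_functional_inner:
  fixes w :: "'a::euclidean_space \<Rightarrow> 'v::euclidean_space"
  assumes w: "square_integrable A w"
  shows "Y2_functional A (\<lambda>u. \<integral>x. u x \<bullet> w x \<partial>lebesgue_on A)"
  unfolding Y2_functional_def
proof (intro conjI ballI allI exI[of _ "l2norm A w"])
  have int: "integrable (lebesgue_on A) (\<lambda>x. u x \<bullet> w x)" if "u \<in> Y2 A" for u
    using that w by (auto simp: Y2_def intro: integrable_inner_square_integrable)
  fix u v :: "'a \<Rightarrow> 'v" assume u: "u \<in> Y2 A"
  show "(\<integral>x. (u x + v x) \<bullet> w x \<partial>lebesgue_on A) =
    (\<integral>x. u x \<bullet> w x \<partial>lebesgue_on A) + (\<integral>x. v x \<bullet> w x \<partial>lebesgue_on A)" if "v \<in> Y2 A"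
    using int[OF u] int[OF that] by (simp add: inner_add_left)
  show "(\<integral>x. (c *\<^sub>R u x) \<bullet> w x \<partial>lebesgue_on A) = c * (\<integral>x. u x \<bullet> w x \<partial>lebesgue_on A)" for c
    by simp
  have "\<bar>\<integral>x. u x \<bullet> w x \<partial>lebesgue_on A\<bar> \<le> l2norm A u * l2norm A w"
    using u w by (auto simp: Y2_def intro: integral_inner_le_l2norm)
  also have "\<dots> \<le> Y2_norm A u * l2norm A w"
    unfolding Y2_norm_def
    by (intro mult_right_mono real_le_rsqrt) (auto simp: l2norm_def sum_nonneg)
  finally show "\<bar>\<integral>x. u x \<bullet> w x \<partial>lebesgue_on A\<bar> \<le> l2norm A w * Y2_norm A u"
    by (simp add: mult.commute)
qed

lemma Y2_weak_limit_eq_l2_limit: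
  assumes weak: "Y2_weakly_converges A u v" and g: "square_integrable A g"
    and lim: "(\<lambda>k. l2norm A (\<lambda>x. u k x - g x)) \<longlonglongrightarrow> 0"
  shows "AE x in lebesgue_on A. v x = g x"
proof -
  define w where "w = (\<lambda>x. v x - g x)"
  have v: "square_integrable A v" and u: "square_integrable A (u k)" for k
    using weak by (auto simp: Y2_weakly_converges_def Y2_def)
  have w: "square_integrable A w" unfolding w_def by (intro square_integrable_diff v g)
  let ?L = "\<lambda>u. \<integral>x. u x \<bullet> w x \<partial>lebesgue_on A"
  have int: "integrable (lebesgue_on A) (\<lambda>x. f x \<bullet> w x)" if "square_integrable A f" for f
    using that w by (rule integrable_inner_square_integrable)
  have "(\<lambda>k. ?L (u k)) \<longlonglongrightarrow> ?L v"
    using weak Y2_functional_inner[OF w] by (auto simp: Y2_weakly_converges_def)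
  then have 1: "(\<lambda>k. ?L (u k) - ?L g) \<longlonglongrightarrow> ?L v - ?L g"
    by (intro tendsto_diff) auto
  have "(\<lambda>k. ?L (u k) - ?L g) \<longlonglongrightarrow> 0"
  proof (rule Lim_null_comparison)
    show "(\<lambda>k. l2norm A (\<lambda>x. u k x - g x) * l2norm A w) \<longlonglongrightarrow> 0"
      using tendsto_mult_left_zero[OF lim] by simp
    have "norm (?L (u k) - ?L g) \<le> l2norm A (\<lambda>x. u k x - g x) * l2norm A w" for k
      using integral_inner_le_l2norm[OF square_integrable_diff[OF u g] w, of k] int[OF u] int[OF g]
      by (simp add: inner_diff_left)
    then show "\<forall>\<^sub>F k in sequentially. norm (?L (u k) - ?L g)
        \<le> l2norm A (\<lambda>x. u k x - g x) * l2norm A w" by simp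
  qed
  then have "?L v - ?L g = 0" using 1 LIMSEQ_unique by blast
  then have "(\<integral>x. (norm (w x))\<^sup>2 \<partial>lebesgue_on A) = 0"
    using int[OF v] int[OF g] by (simp add: w_def power2_norm_eq_inner inner_diff_left)
  then have "AE x in lebesgue_on A. (norm (w x))\<^sup>2 = 0"
    using w by (subst (asm) integral_nonneg_eq_0_iff_AE) (auto simp: square_integrable_def)
  then show ?thesis by eventually_elim (simp add: w_def)
qed

lemma norm_diff_telescope_square_le:
  fixes y :: "nat \<Rightarrow> 'v::real_normed_vector"
  shows "(norm (y j - y 0))\<^sup>2 \<le> (\<Sum>k=1..j. 2 ^ k * (norm (y (k - 1) - y k))\<^sup>2)"
proof -
  let ?n = "\<lambda>k. norm (y (k - 1) - y k)"
  have geo: "(\<Sum>k=1..j. 1 / 2 ^ k) = 1 - 1 / (2::real) ^ j"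
    by (induction j) (auto simp: field_simps)
  have "norm (y j - y 0) \<le> (\<Sum>k=1..j. ?n k)"
  proof (induction j)
    case (Suc j)
    have "y (Suc j) - y 0 = (y j - y 0) - (y j - y (Suc j))" by simp
    then have "norm (y (Suc j) - y 0) \<le> norm (y j - y 0) + norm (y j - y (Suc j))"
      by (metis norm_triangle_ineq4)
    with Suc show ?case by simp
  qed simp
  also have "(\<Sum>k=1..j. ?n k) = (\<Sum>k=1..j. (sqrt (2 ^ k) * ?n k) * sqrt (1 / 2 ^ k))"
    by (intro sum.cong) (auto simp: real_sqrt_divide)
  finally have "(norm (y j - y 0))\<^sup>2 \<le>
      (\<Sum>k=1..j. (sqrt (2 ^ k) * ?n k) * sqrt (1 / 2 ^ k))\<^sup>2"
    by (intro power_mono) auto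
  also have "\<dots> \<le> (\<Sum>k=1..j. (sqrt (2 ^ k) * ?n k)\<^sup>2) * (\<Sum>k=1..j. (sqrt (1 / 2 ^ k))\<^sup>2)"
    by (rule Cauchy_Schwarz_ineq_sum)
  also have "\<dots> = (\<Sum>k=1..j. 2 ^ k * (?n k)\<^sup>2) * (1 - 1 / 2 ^ j)"
    using geo by (simp add: power_mult_distrib)
  also have "\<dots> \<le> (\<Sum>k=1..j. 2 ^ k * (?n k)\<^sup>2) * 1"
    by (intro mult_left_mono sum_nonneg) auto
  finally show ?thesis by simp
qed

lemma Y2_Q_square_integrable:
  assumes "f \<in> Y2_Q \<xi> A"
  shows "square_integrable A (\<lambda>x. \<xi> (f x))"
  using assms by (simp add: Y2_Q_def Y2_def comp_def)

lemma step_minimizing_competitors: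
  fixes \<xi> :: "(real ^ 'n) multiset \<Rightarrow> real ^ 'q::{finite,linorder} ^ 'p::finite"
  assumes "step_minimizing \<xi> f0 h f" "f0 \<in> Y2_Q \<xi> unit_cball"
    and "strictly_defined unit_cball (\<xi> \<circ> f0)"
  shows "f k \<in> competitors \<xi> f0"
proof (cases k)
  case 0
  have "f 1 \<in> competitors \<xi> f0" "f 0 = f0" using assms(1) by (auto simp: step_minimizing_def)
  with 0 assms(2,3) show ?thesis unfolding competitors_def by blast
next
  case (Suc _)
  with assms(1) show ?thesis by (auto simp: step_minimizing_def)
qed

lemma step_minimizing_energy:
  fixes \<xi> :: "(real ^ 'n) multiset \<Rightarrow> real ^ 'q::{finite,linorder} ^ 'p::finite"
    and f0 :: "'a::euclidean_space \<Rightarrow> (real ^ 'n) multiset"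
  assumes step: "step_minimizing \<xi> f0 h f" and h: "h > 0"
    and f0: "f0 \<in> Y2_Q \<xi> unit_cball" "strictly_defined unit_cball (\<xi> \<circ> f0)"
    and Dir: "Dir TYPE('q) f0 unit_cball < \<infinity>"
  shows "(\<Sum>k=1..j. 2 ^ k * (l2norm unit_cball (\<lambda>x. \<xi> (f (k - 1) x) - \<xi> (f k x)))\<^sup>2)
    \<le> h * enn2real (Dir TYPE('q) f0 unit_cball)"
proof -
  define E where "E k = 1 / (h / 2 ^ k) *
      (l2norm unit_cball (\<lambda>x. \<xi> (f (k - 1) x) - \<xi> (f k x)))\<^sup>2" for k
  have E: "0 \<le> E k" for k using h by (simp add: E_def)
  have decr: "Dir TYPE('q) (f (Suc k)) unit_cball + ennreal (E (Suc k))
      \<le> Dir TYPE('q) (f k) unit_cball" for k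
  proof -
    have "step_functional \<xi> (Suc k) (f k) (f (Suc k)) h \<le> step_functional \<xi> (Suc k) (f k) (f k) h"
      using step step_minimizing_competitors[OF step f0, of k]
      unfolding step_minimizing_def by (metis diff_Suc_1 le_add1 plus_1_eq_Suc)
    then show ?thesis by (simp add: step_functional_def E_def l2norm_def)
  qed
  have "Dir TYPE('q) (f j) unit_cball + (\<Sum>k=1..j. ennreal (E k)) \<le> Dir TYPE('q) f0 unit_cball"
  proof (induction j)
    case 0
    then show ?case using step by (simp add: step_minimizing_def)
  next
    case (Suc j)
    have "Dir TYPE('q) (f (Suc j)) unit_cball + (\<Sum>k=1..Suc j. ennreal (E k)) =
      (Dir TYPE('q) (f (Suc j)) unit_cball + ennreal (E (Suc j))) + (\<Sum>k=1..j. ennreal (E k))"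
      by (simp add: ac_simps)
    also have "\<dots> \<le> Dir TYPE('q) (f j) unit_cball + (\<Sum>k=1..j. ennreal (E k))"
      by (intro add_right_mono decr)
    finally show ?case using Suc by (rule order_trans)
  qed
  then have "(\<Sum>k=1..j. ennreal (E k)) \<le> Dir TYPE('q) f0 unit_cball"
    by (rule order_trans[rotated]) simp
  then have "enn2real (ennreal (\<Sum>k=1..j. E k)) \<le> enn2real (Dir TYPE('q) f0 unit_cball)"
    using Dir E by (intro enn2real_mono) auto
  then have "(\<Sum>k=1..j. E k) \<le> enn2real (Dir TYPE('q) f0 unit_cball)"
    using E by (simp add: sum_nonneg)
  then have "h * (\<Sum>k=1..j. E k) \<le> h * enn2real (Dir TYPE('q) f0 unit_cball)"
    using h by (intro mult_left_mono) auto
  then show ?thesis using h by (simp add: E_def sum_distrib_left)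
qed

lemma step_minimizing_l2_distance:
  fixes \<xi> :: "(real ^ 'n) multiset \<Rightarrow> real ^ 'q::{finite,linorder} ^ 'p::finite"
    and f0 :: "'a::euclidean_space \<Rightarrow> (real ^ 'n) multiset"
  assumes step: "step_minimizing \<xi> f0 h f" and h: "h > 0"
    and f0: "f0 \<in> Y2_Q \<xi> unit_cball" "strictly_defined unit_cball (\<xi> \<circ> f0)"
    and Dir: "Dir TYPE('q) f0 unit_cball < \<infinity>"
  shows "(l2norm unit_cball (\<lambda>x. \<xi> (f j x) - \<xi> (f0 x)))\<^sup>2
    \<le> h * enn2real (Dir TYPE('q) f0 unit_cball)"
proof -
  let ?M = "lebesgue_on (unit_cball :: 'a set)"
  have sq: "square_integrable unit_cball (\<lambda>x. \<xi> (f k x))" for k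
    using step_minimizing_competitors[OF step f0, of k]
    by (intro Y2_Q_square_integrable) (auto simp: competitors_def)
  have int: "integrable ?M (\<lambda>x. (norm (\<xi> (f k x) - \<xi> (f l x)))\<^sup>2)" for k l
    using square_integrable_diff[OF sq sq, of k l] by (simp add: square_integrable_def)
  have l2: "(l2norm unit_cball u)\<^sup>2 = (\<integral>x. (norm (u x))\<^sup>2 \<partial>?M)" 
    for u :: "'a \<Rightarrow> real ^ 'q::{finite,linorder} ^ 'p"
    by (simp add: l2norm_def)
  have "(\<integral>x. (norm (\<xi> (f j x) - \<xi> (f 0 x)))\<^sup>2 \<partial>?M) \<le>
      (\<integral>x. (\<Sum>k=1..j. 2 ^ k * (norm (\<xi> (f (k - 1) x) - \<xi> (f k x)))\<^sup>2) \<partial>?M)"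
    using int by (intro integral_mono norm_diff_telescope_square_le[where y = "\<lambda>k. \<xi> (f k _)"]
        Bochner_Integration.integrable_sum) auto
  also have "\<dots> = (\<Sum>k=1..j. 2 ^ k * (l2norm unit_cball (\<lambda>x. \<xi> (f (k - 1) x) - \<xi> (f k x)))\<^sup>2)"
    using int unfolding l2 by (subst Bochner_Integration.integral_sum) auto
  also have "\<dots> \<le> h * enn2real (Dir TYPE('q) f0 unit_cball)"
    by (rule step_minimizing_energy[OF step h f0 Dir])
  finally show ?thesis using step by (simp add: l2 step_minimizing_def)
qed

lemma interpolation_l2_distance:
  fixes \<xi> :: "(real ^ 'n) multiset \<Rightarrow> real ^ 'q::{finite,linorder} ^ 'p::finite"
    and f0 :: "'a::euclidean_space \<Rightarrow> (real ^ 'n) multiset"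
  assumes step: "step_minimizing \<xi> f0 h f" and h: "h > 0"
    and f0: "f0 \<in> Y2_Q \<xi> unit_cball" "strictly_defined unit_cball (\<xi> \<circ> f0)"
    and Dir: "Dir TYPE('q) f0 unit_cball < \<infinity>"
    and \<rho>: "range \<rho> \<subseteq> \<xi> ` qtuples CARD('q)" "\<And>p. p \<in> \<xi> ` qtuples CARD('q) \<Longrightarrow> \<rho> p = p"
    and L: "L-lipschitz_on UNIV \<rho>" and t: "t \<ge> 0"
  shows "(\<integral>\<^sup>+x. ennreal ((norm (\<xi> (interpolation \<xi> \<rho> h f (t, x)) - \<xi> (f0 x)))\<^sup>2)
      \<partial>lebesgue_on unit_cball)
    \<le> ennreal ((2 + 4 * L\<^sup>2) * h * enn2real (Dir TYPE('q) f0 unit_cball))"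
proof -
  let ?B = "unit_cball :: 'a set" and ?D = "enn2real (Dir TYPE('q) f0 unit_cball)"
  let ?d = "\<lambda>k x. norm (\<xi> (f k x) - \<xi> (f0 x))"
  define i where "i = nat \<lfloor>t / h\<rfloor> + 1"
  define \<delta> where "\<delta> = h / 2 ^ i"
  have \<delta>: "\<delta> > 0" using h by (simp add: \<delta>_def)
  have "t / h < real i" using t h by (simp add: i_def) linarith
  then have ti: "t < real i * h" using h by (simp add: field_simps)
  have Lpos: "0 \<le> L" using L by (rule lipschitz_on_nonneg)
  have comp: "f k \<in> Y2_Q \<xi> ?B" for k
    using step_minimizing_competitors[OF step f0, of k] by (simp add: competitors_def)
  have two: "(x + y)\<^sup>2 \<le> 2 * (x\<^sup>2 + y\<^sup>2)" for x y :: real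
    using zero_le_power2[of "x - y"] by (simp add: power2_eq_square algebra_simps)
  have pw: "(norm (\<xi> (interpolation \<xi> \<rho> h f (t, x)) - \<xi> (f0 x)))\<^sup>2
      \<le> (1 + 2 * L\<^sup>2) * ((?d (i - 1) x)\<^sup>2 + (?d i x)\<^sup>2)" if x: "x \<in> ?B" for x
  proof (cases "t \<le> real i * h - \<delta>")
    case True
    then have "interpolation \<xi> \<rho> h f (t, x) = f (i - 1) x"
      unfolding interpolation_def prod.case Let_def i_def[symmetric] \<delta>_def[symmetric] by simp
    then have "(norm (\<xi> (interpolation \<xi> \<rho> h f (t, x)) - \<xi> (f0 x)))\<^sup>2 =
        1 * ((?d (i - 1) x)\<^sup>2 + 0)" by simp
    also have "\<dots> \<le> (1 + 2 * L\<^sup>2) * ((?d (i - 1) x)\<^sup>2 + (?d i x)\<^sup>2)"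
      by (intro mult_mono add_left_mono) auto
    finally show ?thesis .
  next
    case False
    define a where "a = (real i * h - t) / \<delta>"
    define b where "b = (t - (real i * h - \<delta>)) / \<delta>"
    have ab: "0 \<le> a" "0 \<le> b" "a + b = 1"
      using False \<delta> ti by (auto simp: a_def b_def field_simps)
    let ?p = "a *\<^sub>R \<xi> (f (i - 1) x) + b *\<^sub>R \<xi> (f i x)"
    have "interpolation \<xi> \<rho> h f (t, x) = inv_into (qtuples CARD('q)) \<xi> (\<rho> ?p)"
      using False
      unfolding interpolation_def prod.case Let_def i_def[symmetric] \<delta>_def[symmetric] a_def b_def
      by simp
    then have eq: "\<xi> (interpolation \<xi> \<rho> h f (t, x)) = \<rho> ?p"
      using \<rho>(1) by (simp add: f_inv_into_f image_subset_iff)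
    have "f0 x \<in> qtuples CARD('q)" using f0(1) x by (simp add: Y2_Q_def)
    then have fix0: "\<rho> (\<xi> (f0 x)) = \<xi> (f0 x)" using \<rho>(2) by blast
    have "?p - \<xi> (f0 x) = ?p - (a + b) *\<^sub>R \<xi> (f0 x)" using ab by simp
    also have "\<dots> = a *\<^sub>R (\<xi> (f (i - 1) x) - \<xi> (f0 x)) + b *\<^sub>R (\<xi> (f i x) - \<xi> (f0 x))"
      by (simp add: algebra_simps)
    finally have "norm (?p - \<xi> (f0 x)) \<le> a * ?d (i - 1) x + b * ?d i x"
      using ab by (metis abs_of_nonneg norm_scaleR norm_triangle_ineq)
    also have "\<dots> \<le> 1 * ?d (i - 1) x + 1 * ?d i x"
      using ab by (intro add_mono mult_right_mono) auto
    finally have p: "norm (?p - \<xi> (f0 x)) \<le> ?d (i - 1) x + ?d i x" by simp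
    have "norm (\<rho> ?p - \<rho> (\<xi> (f0 x))) \<le> L * norm (?p - \<xi> (f0 x))"
      using lipschitz_onD[OF L] by (simp add: dist_norm)
    also have "\<dots> \<le> L * (?d (i - 1) x + ?d i x)" using p Lpos by (rule mult_left_mono)
    finally have "(norm (\<rho> ?p - \<rho> (\<xi> (f0 x))))\<^sup>2 \<le> (L * (?d (i - 1) x + ?d i x))\<^sup>2"
      by (intro power_mono) auto
    also have "\<dots> = L\<^sup>2 * (?d (i - 1) x + ?d i x)\<^sup>2" by (simp add: power_mult_distrib)
    also have "\<dots> \<le> L\<^sup>2 * (2 * ((?d (i - 1) x)\<^sup>2 + (?d i x)\<^sup>2))"
      by (intro mult_left_mono two) auto
    also have "\<dots> \<le> (1 + 2 * L\<^sup>2) * ((?d (i - 1) x)\<^sup>2 + (?d i x)\<^sup>2)"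
      by (simp add: algebra_simps)
    finally show ?thesis by (simp add: eq fix0)
  qed
  have sq: "square_integrable ?B (\<lambda>x. \<xi> (f k x) - \<xi> (f0 x))" for k
    by (intro square_integrable_diff Y2_Q_square_integrable comp f0(1))
  then have int: "integrable (lebesgue_on ?B) (\<lambda>x. (?d k x)\<^sup>2)" for k
    by (simp add: square_integrable_def)
  have dist: "(\<integral>x. (?d k x)\<^sup>2 \<partial>lebesgue_on ?B) \<le> h * ?D" for k
    using step_minimizing_l2_distance[OF step h f0 Dir, of k] by (simp add: l2norm_def)
  have "(\<integral>\<^sup>+x. ennreal ((norm (\<xi> (interpolation \<xi> \<rho> h f (t, x)) - \<xi> (f0 x)))\<^sup>2) \<partial>lebesgue_on ?B)
    \<le> (\<integral>\<^sup>+x. ennreal ((1 + 2 * L\<^sup>2) * ((?d (i - 1) x)\<^sup>2 + (?d i x)\<^sup>2)) \<partial>lebesgue_on ?B)"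
    using pw by (intro nn_integral_mono ennreal_leI) simp
  also have "\<dots> = ennreal (\<integral>x. (1 + 2 * L\<^sup>2) * ((?d (i - 1) x)\<^sup>2 + (?d i x)\<^sup>2) \<partial>lebesgue_on ?B)"
    using int by (intro nn_integral_eq_integral) auto
  also have "\<dots> = ennreal ((1 + 2 * L\<^sup>2) * ((\<integral>x. (?d (i - 1) x)\<^sup>2 \<partial>lebesgue_on ?B)
      + (\<integral>x. (?d i x)\<^sup>2 \<partial>lebesgue_on ?B)))"
    using int by simp
  also have "\<dots> \<le> ennreal ((1 + 2 * L\<^sup>2) * (h * ?D + h * ?D))"
    by (intro ennreal_leI mult_left_mono add_mono dist) auto
  also have "(1 + 2 * L\<^sup>2) * (h * ?D + h * ?D) = (2 + 4 * L\<^sup>2) * h * ?D"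
    by (simp add: algebra_simps)
  finally show ?thesis .
qed

lemma weak_limit_stationary:
  fixes \<xi> :: "(real ^ 'n) multiset \<Rightarrow> real ^ 'q::{finite,linorder} ^ 'p::finite"
    and f0 :: "'a::euclidean_space \<Rightarrow> (real ^ 'n) multiset"
    and F :: "real \<times> 'a \<Rightarrow> (real ^ 'n) multiset"
  assumes \<rho>: "lipschitz_retraction_onto (\<xi> ` qtuples CARD('q)) \<rho>"
    and f0: "f0 \<in> Y2_Q \<xi> unit_cball" "strictly_defined unit_cball (\<xi> \<circ> f0)"
    and Dir: "Dir TYPE('q) f0 unit_cball < \<infinity>"
    and step: "\<And>k. step_minimizing \<xi> f0 (h k) (f k)"
    and h: "\<And>k. h k > 0" "h \<longlonglongrightarrow> 0"
    and weak: "Y2_weakly_converges ({0..T} \<times> unit_cball)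
      (\<lambda>k. \<xi> \<circ> interpolation \<xi> \<rho> (h k) (f k)) (\<xi> \<circ> F)"
    and T: "T > 0"
  shows "AE z in lebesgue_on ({0..T} \<times> unit_cball). \<xi> (F z) = \<xi> (f0 (snd z))"
proof -
  let ?B = "unit_cball :: 'a set" and ?D = "enn2real (Dir TYPE('q) f0 unit_cball)"
  let ?A = "{0..T} \<times> ?B"
  let ?u = "\<lambda>k z. (\<xi> \<circ> interpolation \<xi> \<rho> (h k) (f k)) z - \<xi> (f0 (snd z))"
  obtain L where L: "L-lipschitz_on UNIV \<rho>"
    and \<rho>': "range \<rho> \<subseteq> \<xi> ` qtuples CARD('q)" "\<And>p. p \<in> \<xi> ` qtuples CARD('q) \<Longrightarrow> \<rho> p = p"
    using \<rho> by (auto simp: lipschitz_retraction_onto_def)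
  have g: "square_integrable ?A (\<lambda>z. \<xi> (f0 (snd z)))"
    by (rule square_integrable_snd[OF _ _ Y2_Q_square_integrable[OF f0(1)]]) auto
  have "square_integrable ?A (\<xi> \<circ> interpolation \<xi> \<rho> (h k) (f k))" for k
    using weak unfolding Y2_weakly_converges_def Y2_def by blast
  then have u: "square_integrable ?A (?u k)" for k
    using g by (rule square_integrable_diff)
  define C where "C = T * ((2 + 4 * L\<^sup>2) * ?D)"
  have "(l2norm ?A (?u k))\<^sup>2 \<le> C * h k" for k
  proof -
    have m: "(\<lambda>z. ennreal ((norm (?u k z))\<^sup>2)) \<in> borel_measurable (lebesgue_on ?A)"
      using u[of k] by (auto simp: square_integrable_def)
    have "ennreal ((l2norm ?A (?u k))\<^sup>2) = (\<integral>\<^sup>+z. ennreal ((norm (?u k z))\<^sup>2) \<partial>lebesgue_on ?A)"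
      by (rule square_integrable_nn_integral[OF u, symmetric])
    also have "\<dots> = (\<integral>\<^sup>+t. (\<integral>\<^sup>+x. ennreal ((norm (?u k (t, x)))\<^sup>2) \<partial>lebesgue_on ?B)
        \<partial>lebesgue_on {0..T})"
      by (rule nn_integral_lebesgue_on_Times[OF _ _ m]) auto
    also have "\<dots> \<le> (\<integral>\<^sup>+t. ennreal ((2 + 4 * L\<^sup>2) * h k * ?D) \<partial>lebesgue_on {0..T})"
      using interpolation_l2_distance[OF step h(1) f0 Dir \<rho>' L] by (intro nn_integral_mono) auto
    also have "\<dots> = ennreal (C * h k)"
      using T less_imp_le[OF h(1)[of k]]
      by (simp add: emeasure_restrict_space space_restrict_space C_def ac_simps flip: ennreal_mult)
    finally show ?thesis
      using T less_imp_le[OF h(1)[of k]] by (subst (asm) ennreal_le_iff) (auto simp: C_def)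
  qed
  then have bound: "norm (l2norm ?A (?u k)) \<le> sqrt (C * h k)" for k
    by (intro real_le_rsqrt) simp
  have "(\<lambda>k. sqrt (C * h k)) \<longlonglongrightarrow> sqrt (C * 0)"
    by (intro tendsto_intros h(2))
  then have "(\<lambda>k. l2norm ?A (?u k)) \<longlonglongrightarrow> 0"
    by (intro Lim_null_comparison[OF always_eventually[OF allI[OF bound]]]) simp
  from Y2_weak_limit_eq_l2_limit[OF weak g this] show ?thesis by simp
qed

theorem theorem6p3:
  fixes \<xi> :: "(real ^ 'n) multiset \<Rightarrow> real ^ 'q::{finite,linorder} ^ ('c::finite \<times> 'n)"
    and \<rho> :: "real ^ 'q::{finite,linorder} ^ ('c \<times> 'n) \<Rightarrow> real ^ 'q::{finite,linorder} ^ ('c \<times> 'n)"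
    and f0 :: "real ^ 'm \<Rightarrow> (real ^ 'n) multiset"
    and f :: "real \<Rightarrow> nat \<Rightarrow> real ^ 'm \<Rightarrow> (real ^ 'n) multiset"
    and F :: "real \<times> (real ^ 'm) \<Rightarrow> (real ^ 'n) multiset"
    and r :: "nat \<Rightarrow> nat"
  assumes "white_embedding \<xi>"
    and "lipschitz_retraction_onto (\<xi> ` qtuples CARD('q)) \<rho>"
    and "f0 \<in> Y2_Q \<xi> unit_cball"
    and "strictly_defined unit_cball (\<xi> \<circ> f0)"
    and "Dir TYPE('q) f0 unit_cball < \<infinity>"
    and "square_integrable unit_cball (\<xi> \<circ> f0)"
    and "\<And>h. h > 0 \<Longrightarrow> step_minimizing \<xi> f0 h (f h)"
    and "\<And>t x. t \<ge> 0 \<Longrightarrow> x \<in> unit_cball \<Longrightarrow> F (t, x) \<in> qtuples CARD('q)"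
    and "strict_mono r"
    and "\<And>T. T > 0 \<Longrightarrow> Y2_weakly_converges ({0..T} \<times> unit_cball)
      (\<lambda>k. \<xi> \<circ> interpolation \<xi> \<rho> (1 / 2 ^ r k) (f (1 / 2 ^ r k))) (\<xi> \<circ> F)"
  shows "\<exists>N\<in>null_sets lebesgue. \<forall>t s. 0 \<le> t \<longrightarrow> t < s \<longrightarrow> t \<notin> N \<longrightarrow> s \<notin> N \<longrightarrow>
    square_integrable unit_cball (\<lambda>x. \<xi> (F (t, x)) - \<xi> (F (s, x))) \<and>
    l2norm unit_cball (\<lambda>x. \<xi> (F (t, x)) - \<xi> (F (s, x)))
      \<le> sqrt (s - t) * sqrt (enn2real (Dir TYPE('q) f0 unit_cball))"
proof -
  let ?B = "unit_cball :: (real ^ 'm) set"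
  let ?P = "\<lambda>t. AE x in lebesgue. 0 \<le> t \<and> x \<in> ?B \<longrightarrow> \<xi> (F (t, x)) = \<xi> (f0 x)"
  have "(\<lambda>n. (1 / 2) ^ r n :: real) \<longlonglongrightarrow> 0"
    using LIMSEQ_subseq_LIMSEQ[OF LIMSEQ_power_zero[of "1 / 2 :: real"] assms(9)]
    by (simp add: comp_def)
  then have h: "(\<lambda>n. 1 / 2 ^ r n :: real) \<longlonglongrightarrow> 0" by (simp add: power_one_over)
  have "AE z in lebesgue_on ({0..real (Suc n)} \<times> ?B). \<xi> (F z) = \<xi> (f0 (snd z))" for n
    by (rule weak_limit_stationary[OF assms(2-5) assms(7) _ h assms(10)]) auto
  then have "AE z in lebesgue. z \<in> {0..real (Suc n)} \<times> ?B \<longrightarrow> \<xi> (F z) = \<xi> (f0 (snd z))" for n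
    by (subst (asm) AE_restrict_space_iff) (auto intro!: lebesgue_Times)
  then have "AE z in lebesgue. \<forall>n. z \<in> {0..real (Suc n)} \<times> ?B \<longrightarrow> \<xi> (F z) = \<xi> (f0 (snd z))"
    by (simp only: AE_all_countable) blast
  then have "AE z in lebesgue. 0 \<le> fst z \<and> snd z \<in> ?B \<longrightarrow> \<xi> (F z) = \<xi> (f0 (snd z))"
  proof eventually_elim
    case (elim z)
    obtain n where "fst z \<le> real n" using real_arch_simple by blast
    then have "fst z \<le> real (Suc n)" by simp
    with elim show ?case by (cases z) auto
  qed
  then have "AE t in lebesgue. ?P t"
    by (rule AE_lebesgue_pair[THEN AE_mp]) simp
  then obtain N where N: "N \<in> null_sets lebesgue" "{t. \<not> ?P t} \<subseteq> N"
    by (auto simp: eventually_ae_filter)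
  show ?thesis
  proof (intro bexI[OF _ N(1)] allI impI)
    fix t s :: real assume ts: "0 \<le> t" "t < s" "t \<notin> N" "s \<notin> N"
    let ?w = "\<lambda>x. \<xi> (F (t, x)) - \<xi> (F (s, x))"
    have "?P t" "?P s" using ts(3,4) N(2) by blast+
    then have w0: "AE x in lebesgue. x \<in> ?B \<longrightarrow> ?w x = 0"
      by eventually_elim (use ts in auto)
    then have ae: "AE x in lebesgue_on ?B. ?w x = 0"
      by (subst AE_restrict_space_iff) auto
    have "(\<lambda>x. if x \<in> ?B then ?w x else 0) \<in> borel_measurable lebesgue"
    proof (rule borel_measurable_AE)
      show "(\<lambda>x. 0 :: real ^ 'q::{finite,linorder} ^ ('c \<times> 'n)) \<in> borel_measurable lebesgue" by simp
      show "AE x in lebesgue. 0 = (if x \<in> ?B then ?w x else 0)"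
        using w0 by eventually_elim simp
    qed
    then have m: "?w \<in> borel_measurable (lebesgue_on ?B)"
      by (rule borel_measurable_if_D)
    have ae2: "AE x in lebesgue_on ?B. (norm (?w x))\<^sup>2 = 0"
      using ae by eventually_elim simp
    have "integrable (lebesgue_on ?B) (\<lambda>x. (norm (?w x))\<^sup>2)"
      using m ae2 by (subst integrable_cong_AE[where g = "\<lambda>x. 0"]) auto
    moreover have "l2norm ?B ?w = 0"
      using ae2 by (simp add: l2norm_def integral_eq_zero_AE)
    ultimately show "square_integrable ?B ?w \<and>
        l2norm ?B ?w \<le> sqrt (s - t) * sqrt (enn2real (Dir TYPE('q) f0 unit_cball))"
      using m ts by (simp add: square_integrable_def)
  qed
qed

end
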